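(* Let $m,n$ be distinct square-free rational integers such that $K=\mathbb{Q}(\sqrt{m},\sqrt{n})$ is a quartic number field, let $\mathcal{A}=\mathbb{Z}[\sqrt{m},\sqrt{n}]$, and let $\sigma,\tau$ be any two non-zero ring endomorphisms of $\mathcal{A}$. A non-zero $\mathbb{Z}$-linear map $D:\mathcal{A}\to\mathcal{A}$ with $D(1)=0$ is a $(\sigma,\tau)$-derivation if and only if exactly one of the following cases holds: (i) $D(\sqrt{m})=0$, $D(\sqrt{n})\neq 0$, $D(\sqrt{mn})\neq 0$, and either $(\sigma,\tau)\in\{(\phi_{1},\phi_{2}),(\phi_{2},\phi_{1})\}$ and $D(\sqrt{mn})=\sqrt{m}\,D(\sqrt{n})$, or $(\sigma,\tau)\in\{(\phi_{3},\phi_{4}),(\phi_{4},\phi_{3})\}$ and $D(\sqrt{mn})=-\sqrt{m}\,D(\sqrt{n})$. (ii) $D(\sqrt{m})\neq 0$, $D(\sqrt{n})=0$, $D(\sqrt{mn})\neq 0$, and either $(\sigma,\tau)\in\{(\phi_{1},\phi_{3}),(\phi_{3},\phi_{1})\}$ and $D(\sqrt{mn})=\sqrt{n}\,D(\sqrt{m})$, or $(\sigma,\tau)\in\{(\phi_{2},\phi_{4}),(\phi_{4},\phi_{2})\}$ and $D(\sqrt{mn})=-\sqrt{n}\,D(\sqrt{m})$. (iii) $D(\sqrt{m})\neq 0$, $D(\sqrt{n})\neq 0$, $D(\sqrt{mn})=0$, and either $(\sigma,\tau)\in\{(\phi_{1},\phi_{4}),(\phi_{4},\phi_{1})\}$ and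 $\sqrt{m}\,D(\sqrt{n})=\sqrt{n}\,D(\sqrt{m})$, or $(\sigma,\tau)\in\{(\phi_{2},\phi_{3}),(\phi_{3},\phi_{2})\}$ and $\sqrt{m}\,D(\sqrt{n})=-\sqrt{n}\,D(\sqrt{m})$.
   Context: Here $\sqrt{mn}$ denotes $\sqrt{m}\cdot\sqrt{n}$, and $\{1,\sqrt{m},\sqrt{n},\sqrt{mn}\}$ is a $\mathbb{Z}$-basis of $\mathcal{A}$. A $(\sigma,\tau)$-derivation of $\mathcal{A}$ is a $\mathbb{Z}$-linear map $D:\mathcal{A}\to\mathcal{A}$ with $D(xy)=D(x)\tau(y)+\sigma(x)D(y)$ for all $x,y\in\mathcal{A}$. The non-zero ring endomorphisms of $\mathcal{A}$ are $\phi_{1},\phi_{2},\phi_{3},\phi_{4}$, determined by: $\phi_{1}(\sqrt{m})=\sqrt{m}$, $\phi_{1}(\sqrt{n})=\sqrt{n}$; $\phi_{2}(\sqrt{m})=\sqrt{m}$, $\phi_{2}(\sqrt{n})=-\sqrt{n}$; $\phi_{3}(\sqrt{m})=-\sqrt{m}$, $\phi_{3}(\sqrt{n})=\sqrt{n}$; $\phi_{4}(\sqrt{m})=-\sqrt{m}$, $\phi_{4}(\sqrt{n})=-\sqrt{n}$. *)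

theory Defs
  imports
    "HOL-Algebra.Generated_Fields"
    "HOL-Algebra.Algebraic_Closure_Type"
    "HOL-Computational_Algebra.Squarefree"
    "HOL-Library.FuncSet"
    Complex_Main
begin

abbreviation complex_ring :: "complex ring" where
  "complex_ring \<equiv> ring_of_type_algebra"

(* csqrt is the principal square root, so for k < 0 this is i * sqrt (-k).  Note that
   rt m * rt n need not be rt (m * n) when m and n are both negative. *)
abbreviation rt :: "int \<Rightarrow> complex" where
  "rt k \<equiv> csqrt (of_int k)"

definition biquad_field :: "int \<Rightarrow> int \<Rightarrow> complex set" where
  "biquad_field m n = generate_field complex_ring (\<rat> \<union> {rt m, rt n})"

definition biquad_ring :: "int \<Rightarrow> int \<Rightarrow> complex set" where
  "biquad_ring m n = generate_ring complex_ring {rt m, rt n}"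

(* Not required to preserve 1.  Maps are extensional, so that two endomorphisms of A are
   equal in HOL as soon as they agree on A. *)
definition nonzero_ring_endos :: "'a::ring_1 set \<Rightarrow> ('a \<Rightarrow> 'a) set" where
  "nonzero_ring_endos A = {f \<in> A \<rightarrow>\<^sub>E A.
     (\<forall>x\<in>A. \<forall>y\<in>A. f (x + y) = f x + f y) \<and>
     (\<forall>x\<in>A. \<forall>y\<in>A. f (x * y) = f x * f y) \<and>
     (\<exists>x\<in>A. f x \<noteq> 0)}"

(* Meaningful when 1, rt m, rt n, rt m * rt n are linearly independent over the rationals
   and a = rt m or - rt m, b = rt n or - rt n: then exactly one f qualifies. *)
definition biquad_endo :: "int \<Rightarrow> int \<Rightarrow> complex \<Rightarrow> complex \<Rightarrow> (complex \<Rightarrow> complex)" where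
  "biquad_endo m n a b =
     (THE f. f \<in> nonzero_ring_endos (biquad_ring m n) \<and> f (rt m) = a \<and> f (rt n) = b)"

definition phi1 :: "int \<Rightarrow> int \<Rightarrow> complex \<Rightarrow> complex" where
  "phi1 m n = biquad_endo m n (rt m) (rt n)"

definition phi2 :: "int \<Rightarrow> int \<Rightarrow> complex \<Rightarrow> complex" where
  "phi2 m n = biquad_endo m n (rt m) (- rt n)"

definition phi3 :: "int \<Rightarrow> int \<Rightarrow> complex \<Rightarrow> complex" where
  "phi3 m n = biquad_endo m n (- rt m) (rt n)"

definition phi4 :: "int \<Rightarrow> int \<Rightarrow> complex \<Rightarrow> complex" where
  "phi4 m n = biquad_endo m n (- rt m) (- rt n)"

definition Z_linear_on :: "'a::ring_1 set \<Rightarrow> ('a \<Rightarrow> 'a) \<Rightarrow> bool" where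
  "Z_linear_on A D \<longleftrightarrow> D \<in> A \<rightarrow> A \<and>
     (\<forall>x\<in>A. \<forall>y\<in>A. D (x + y) = D x + D y) \<and>
     (\<forall>k::int. \<forall>x\<in>A. D (of_int k * x) = of_int k * D x)"

definition twisted_derivation ::
  "'a::ring_1 set \<Rightarrow> ('a \<Rightarrow> 'a) \<Rightarrow> ('a \<Rightarrow> 'a) \<Rightarrow> ('a \<Rightarrow> 'a) \<Rightarrow> bool" where
  "twisted_derivation A \<sigma> \<tau> D \<longleftrightarrow> Z_linear_on A D \<and>
     (\<forall>x\<in>A. \<forall>y\<in>A. D (x * y) = D x * \<tau> y + \<sigma> x * D y)"

definition exactly_one :: "bool \<Rightarrow> bool \<Rightarrow> bool \<Rightarrow> bool" where
  "exactly_one P Q R \<longleftrightarrow>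
     (P \<and> \<not> Q \<and> \<not> R) \<or> (\<not> P \<and> Q \<and> \<not> R) \<or> (\<not> P \<and> \<not> Q \<and> R)"

end

theory Submission
  imports Defs
begin

text \<open>
Write a and b for the two square roots. A field of degree 4 is contained in the rational span of
1, a, b, ab, so these four elements are independent; hence the endomorphisms are exactly the four
sign changes. Let s, t and s', t' be the signs of the two endomorphisms. Applying the product rule
to the squares of a and b, whose images under D vanish, gives s' = - s unless D(a) = 0, and t' = - t
unless D(b) = 0; comparing D(ab) with D(ba) gives the remaining relation. Conversely, in each of the
resulting cases the product rule is a polynomial identity on the basis.
\<close>

section \<open>Generating sets of minimal length\<close>

text \<open>Going through the list from its end, each new head either lies in the span of the tail
  and leaves the dimension alone, or raises it by one. The full length is reached only if every head
  was new, which is independence.\<close>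

lemma (in ring) dimension_Span_obtain:
  assumes "subfield K R" and "set Us \<subseteq> carrier R"
  obtains k where "dimension k K (Span K Us)" and "k \<le> length Us"
    and "k = length Us \<Longrightarrow> independent K Us"
proof -
  have "\<exists>k. dimension k K (Span K Us) \<and> k \<le> length Us \<and> (k = length Us \<longrightarrow> independent K Us)"
    using assms(2)
  proof (induction Us)
    case Nil
    then show ?case by (auto intro!: exI[of _ 0])
  next
    case (Cons u Us)
    then obtain k where k: "dimension k K (Span K Us)" "k \<le> length Us"
      "k = length Us \<longrightarrow> independent K Us"
      by auto
    show ?case
    proof (cases "u \<in> Span K Us")
      case True
      then have "Span K (u # Us) = Span K Us"
        using Cons.prems mono_Span_subset[OF assms(1), of "u # Us" Us]
          mono_Span[OF assms(1), of Us u] Span_base_incl[OF assms(1), of Us] by auto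
      \<comment> \<open>Here \<open>k \<le> length Us\<close> is smaller than the length of the
        extended list, so the independence clause holds vacuously.\<close>
      then show ?thesis using k by (intro exI[of _ k]) simp
    next
      case False
      then show ?thesis
        using k Cons.prems Suc_dim[OF _ False k(1)] li_Cons[of u K Us]
        by (intro exI[of _ "Suc k"]) auto
    qed
  qed
  then show ?thesis using that by blast
qed

text \<open>A basis of \<open>E\<close> consists of \<open>n\<close> independent vectors inside the
  span, so the dimension of the span is squeezed between \<open>n\<close> and
  \<open>length Us \<le> n\<close>. Since an inclusion of \<open>E\<close> suffices, the span need
  not be computed exactly.\<close>

lemma (in ring) independent_if_dimension_le:
  assumes K: "subfield K R" and Us: "set Us \<subseteq> carrier R"
    and E: "dimension n K E" and sub: "E \<subseteq> Span K Us" and len: "length Us \<le> n"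
  shows "independent K Us"
proof -
  obtain k where k: "dimension k K (Span K Us)" "k \<le> length Us"
    and ind: "k = length Us \<Longrightarrow> independent K Us"
    using dimension_Span_obtain[OF K Us] by blast
  obtain Vs where Vs: "set Vs \<subseteq> carrier R" "independent K Vs" "length Vs = n" "Span K Vs = E"
    using exists_base[OF K E] by blast
  have "set Vs \<subseteq> Span K Us"
    using Span_base_incl[OF K Vs(1)] Vs(4) sub by blast
  then have "n \<le> k"
    using independent_length_le_dimension[OF K k(1) Vs(2)] Vs(3) by blast
  then show ?thesis using ind k(2) len by simp
qed

section \<open>Quadratic extensions inside a field type\<close>

lemma ring_of_type_algebra_simps [simp]:
  "carrier (ring_of_type_algebra :: 'a::field ring) = UNIV"
  "x \<otimes>\<^bsub>(ring_of_type_algebra :: 'a ring)\<^esub> y = x * y"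
  "x \<oplus>\<^bsub>(ring_of_type_algebra :: 'a ring)\<^esub> y = x + y"
  "\<one>\<^bsub>(ring_of_type_algebra :: 'a ring)\<^esub> = 1"
  "\<zero>\<^bsub>(ring_of_type_algebra :: 'a ring)\<^esub> = 0"
  by (simp_all add: ring_of_type_algebra_def)

lemma ring_of_type_algebra_a_inv [simp]:
  "\<ominus>\<^bsub>(ring_of_type_algebra :: 'a::field ring)\<^esub> x = - x"
proof -
  interpret field "ring_of_type_algebra :: 'a ring" by (rule field_from_type_algebra)
  show ?thesis by (rule minus_equality) auto
qed

text \<open>At zero the two notions part: \<open>inverse 0 = 0\<close> in the type class, while the
  inverse in the ring record is unspecified there.\<close>

lemma ring_of_type_algebra_m_inv:
  assumes "x \<noteq> 0"
  shows "inv\<^bsub>(ring_of_type_algebra :: 'a::field ring)\<^esub> x = inverse x"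
proof -
  interpret field "ring_of_type_algebra :: 'a ring" by (rule field_from_type_algebra)
  show ?thesis by (rule comm_inv_char) (use assms in auto)
qed

lemma subfield_type_algebraI:
  fixes F :: "'a::field set"
  assumes "1 \<in> F" "\<And>x. x \<in> F \<Longrightarrow> - x \<in> F" "\<And>x y. x \<in> F \<Longrightarrow> y \<in> F \<Longrightarrow> x + y \<in> F"
    "\<And>x y. x \<in> F \<Longrightarrow> y \<in> F \<Longrightarrow> x * y \<in> F" "\<And>x. x \<in> F \<Longrightarrow> x \<noteq> 0 \<Longrightarrow> inverse x \<in> F"
  shows "subfield F ring_of_type_algebra"
proof -
  interpret field "ring_of_type_algebra :: 'a ring" by (rule field_from_type_algebra)
  show ?thesis
    by (intro subfieldI' subringI) (use assms in \<open>auto simp: ring_of_type_algebra_m_inv\<close>)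
qed

lemma subfield_type_algebraD:
  fixes F :: "'a::field set"
  assumes "subfield F ring_of_type_algebra"
  shows "0 \<in> F" "1 \<in> F" "x \<in> F \<Longrightarrow> - x \<in> F" "x \<in> F \<Longrightarrow> y \<in> F \<Longrightarrow> x + y \<in> F"
    "x \<in> F \<Longrightarrow> y \<in> F \<Longrightarrow> x - y \<in> F"
    "x \<in> F \<Longrightarrow> y \<in> F \<Longrightarrow> x * y \<in> F" "x \<in> F \<Longrightarrow> inverse x \<in> F"
proof -
  interpret field "ring_of_type_algebra :: 'a ring" by (rule field_from_type_algebra)
  note sub = subringE[OF subfieldE(1)[OF assms], simplified]
  show "0 \<in> F" "1 \<in> F" "x \<in> F \<Longrightarrow> - x \<in> F" "x \<in> F \<Longrightarrow> y \<in> F \<Longrightarrow> x + y \<in> F"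
    "x \<in> F \<Longrightarrow> y \<in> F \<Longrightarrow> x * y \<in> F"
    using sub by blast+
  show "x \<in> F \<Longrightarrow> y \<in> F \<Longrightarrow> x - y \<in> F"
    using sub by (metis add_uminus_conv_diff)
  show "x \<in> F \<Longrightarrow> inverse x \<in> F"
    using subfield_m_inv(1)[OF assms, of x] sub(2)
    by (cases "x = 0") (auto simp: ring_of_type_algebra_m_inv)
qed

section \<open>Adjoining a square root to a field\<close>

definition adjoin_root :: "'a::field set \<Rightarrow> 'a \<Rightarrow> 'a set" where
  "adjoin_root F c = {x + y * c | x y. x \<in> F \<and> y \<in> F}"

lemma adjoin_rootI: "x \<in> F \<Longrightarrow> y \<in> F \<Longrightarrow> x + y * c \<in> adjoin_root F c"
  by (auto simp: adjoin_root_def)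

lemma adjoin_rootE:
  assumes "u \<in> adjoin_root F c"
  obtains x y where "x \<in> F" "y \<in> F" "u = x + y * c"
  using assms by (auto simp: adjoin_root_def)

lemma adjoin_root_incl:
  assumes "subfield F ring_of_type_algebra"
  shows "F \<subseteq> adjoin_root F c" "c \<in> adjoin_root F c"
  unfolding adjoin_root_def using subfield_type_algebraD[OF assms]
  by (auto, metis add_0_right mult_zero_left, metis add_0 mult_1)

text \<open>Inverses are found by rationalising the denominator with the conjugate
  \<open>x - y * c\<close>. For \<open>c\<close> in \<open>F\<close> the conjugate of a non-zero
  element may vanish, but then nothing new is adjoined; hence the case distinction.\<close>

lemma subfield_adjoin_root:
  fixes F :: "'a::field set"
  assumes F: "subfield F ring_of_type_algebra" and c: "c\<^sup>2 \<in> F"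
  shows "subfield (adjoin_root F c) ring_of_type_algebra"
proof (cases "c \<in> F")
  case True
  have "adjoin_root F c = F"
    unfolding adjoin_root_def
    using subfield_type_algebraD[OF F] True by (auto intro: exI[of _ 0]) (metis add_0_right mult_zero_left)
  then show ?thesis using F by simp
next
  case False
  note F' = subfield_type_algebraD[OF F]
  show ?thesis
  proof (rule subfield_type_algebraI)
    show "1 \<in> adjoin_root F c"
      using adjoin_root_incl(1)[OF F] F' by blast
  next
    fix u assume "u \<in> adjoin_root F c"
    then obtain x y where u: "x \<in> F" "y \<in> F" "u = x + y * c" by (rule adjoin_rootE)
    then have "- u = - x + (- y) * c" by simp
    then show "- u \<in> adjoin_root F c"
      by (simp only:) (intro adjoin_rootI F' u)
  next
    fix u v assume "u \<in> adjoin_root F c" "v \<in> adjoin_root F c"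
    then obtain x y x' y' where uv: "x \<in> F" "y \<in> F" "u = x + y * c"
      "x' \<in> F" "y' \<in> F" "v = x' + y' * c" by (elim adjoin_rootE)
    have "u + v = (x + x') + (y + y') * c" using uv by (simp add: algebra_simps)
    then show "u + v \<in> adjoin_root F c"
      by (simp only:) (intro adjoin_rootI F' uv)
    have "u * v = (x * x' + y * y' * c\<^sup>2) + (x * y' + y * x') * c"
      using uv by (simp add: algebra_simps power2_eq_square)
    then show "u * v \<in> adjoin_root F c"
      by (simp only:) (intro adjoin_rootI F' uv c)
  next
    fix u assume "u \<in> adjoin_root F c" "u \<noteq> 0"
    then obtain x y where u: "x \<in> F" "y \<in> F" "u = x + y * c" by (elim adjoin_rootE)
    \<comment> \<open>A vanishing conjugate with \<open>y \<noteq> 0\<close> would give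
      \<open>c = x / y\<close> in \<open>F\<close>; with \<open>y = 0\<close> it would force
      \<open>u = 0\<close>.\<close>
    have conj: "x - y * c \<noteq> 0"
    proof
      assume *: "x - y * c = 0"
      then have "y \<noteq> 0" using u \<open>u \<noteq> 0\<close> by auto
      then have "c = x * inverse y" using * by (simp add: field_simps)
      moreover have "x * inverse y \<in> F" by (intro F' u)
      ultimately show False using False by simp
    qed
    \<comment> \<open>The norm of \<open>u\<close> lies in \<open>F\<close> because \<open>c\<close>
      enters only through its square.\<close>
    let ?N = "x * x - y * y * c\<^sup>2"
    have N: "?N = u * (x - y * c)" using u by (simp add: algebra_simps power2_eq_square)
    have "inverse u = inverse ?N * (x - y * c)"
      unfolding N using conj \<open>u \<noteq> 0\<close> by simp
    then have "inverse u = x * inverse ?N + (- (y * inverse ?N)) * c"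
      by (simp add: algebra_simps)
    then show "inverse u \<in> adjoin_root F c"
      by (simp only:) (intro adjoin_rootI F' u c)
  qed
qed

section \<open>From degree 4 to linear independence\<close>

lemma subfield_Rats: "subfield (\<rat> :: 'a::field_char_0 set) ring_of_type_algebra"
  by (rule subfield_type_algebraI) auto

lemma rt_squared: "rt k * rt k = of_int k"
  by (metis power2_csqrt power2_eq_square)

text \<open>Two successive adjunctions yield a subfield that contains all the generators, hence
  contains the field they generate.\<close>

lemma biquad_field_subset_adjoin:
  "biquad_field m n \<subseteq> adjoin_root (adjoin_root \<rat> (rt m)) (rt n)"
proof -
  interpret field "complex_ring" by (rule field_from_type_algebra)
  have F: "subfield (adjoin_root \<rat> (rt m)) complex_ring"
    by (intro subfield_adjoin_root subfield_Rats) simp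
  have "(rt n)\<^sup>2 \<in> adjoin_root \<rat> (rt m)"
    using subsetD[OF adjoin_root_incl(1)[OF subfield_Rats, of "rt m"]] by simp
  with F have "subfield (adjoin_root (adjoin_root \<rat> (rt m)) (rt n)) complex_ring"
    by (rule subfield_adjoin_root)
  then show ?thesis
    unfolding biquad_field_def
  proof (rule generate_field_min_subfield1[rotated])
    have "\<rat> \<subseteq> adjoin_root (adjoin_root \<rat> (rt m)) (rt n)"
      using adjoin_root_incl(1)[OF subfield_Rats] adjoin_root_incl(1)[OF F] by (rule subset_trans)
    moreover have "rt m \<in> adjoin_root (adjoin_root \<rat> (rt m)) (rt n)"
      by (rule subsetD[OF adjoin_root_incl(1)[OF F] adjoin_root_incl(2)[OF subfield_Rats]])
    moreover have "rt n \<in> adjoin_root (adjoin_root \<rat> (rt m)) (rt n)"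
      by (rule adjoin_root_incl(2)[OF F])
    ultimately show "\<rat> \<union> {rt m, rt n} \<subseteq> adjoin_root (adjoin_root \<rat> (rt m)) (rt n)"
      by simp
  qed simp
qed

text \<open>Expanding \<open>(p + q * rt m) + (r + s * rt m) * rt n\<close> shows that four elements
  span a space containing a field of dimension 4, so the list has no room for a linear
  relation.\<close>

lemma biquad_independent:
  assumes "ring.dimension complex_ring 4 \<rat> (biquad_field m n)"
    and "x \<in> \<rat>" "y \<in> \<rat>" "z \<in> \<rat>" "w \<in> \<rat>"
    and "x + y * rt m + z * rt n + w * (rt m * rt n) = 0"
  shows "x = 0 \<and> y = 0 \<and> z = 0 \<and> w = 0"
proof -
  interpret field "complex_ring" by (rule field_from_type_algebra)
  let ?Us = "[1, rt m, rt n, rt m * rt n]"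
  have "u \<in> Span \<rat> ?Us" if "u \<in> biquad_field m n" for u
  proof -
    from subsetD[OF biquad_field_subset_adjoin that] obtain p q r s where
      "p \<in> \<rat>" "q \<in> \<rat>" "r \<in> \<rat>" "s \<in> \<rat>" "u = (p + q * rt m) + (r + s * rt m) * rt n"
      by (elim adjoin_rootE) simp
    then show ?thesis
      by (subst Span_eq_combine_set[OF subfield_Rats])
        (auto intro!: exI[of _ "[p, q, r, s]"] simp: distrib_right)
  qed
  then have "independent \<rat> ?Us"
    by (intro independent_if_dimension_le[OF subfield_Rats _ assms(1)] subsetI)
      (simp_all del: Span.simps)
  from independent_imp_trivial_combine[OF subfield_Rats this, of "[x, y, z, w]"] assms(2-)
  show ?thesis by (simp add: add.assoc)
qed

section \<open>Sign patterns\<close>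

text \<open>Here p, q, r are the values of D at a, b, ab.\<close>

definition sign_conditions :: "int \<Rightarrow> int \<Rightarrow> int \<Rightarrow> int \<Rightarrow> 'a::comm_ring_1 \<Rightarrow> 'a \<Rightarrow> 'a \<Rightarrow> 'a \<Rightarrow> 'a \<Rightarrow> bool"
  where "sign_conditions s t s' t' a b p q r \<longleftrightarrow>
    s' = s \<and> t' = t \<and> p = 0 \<and> q = 0 \<and> r = 0 \<or>
    s' = s \<and> t' = - t \<and> p = 0 \<and> r = of_int s * a * q \<or>
    s' = - s \<and> t' = t \<and> q = 0 \<and> r = of_int t * b * p \<or>
    s' = - s \<and> t' = - t \<and> a * q = of_int (s * t) * b * p \<and> r = 0"

text \<open>The last four hypotheses are what the product rule yields at a * a, b * b, a * b and b *
  a. A sign that does not flip makes \<open>s + s'\<close> or \<open>t + t'\<close> equal to plus or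
  minus 2, which forces \<open>p\<close> or \<open>q\<close> to vanish.\<close>

lemma sign_conditionsI:
  fixes a b p q r :: "'a::field_char_0"
  assumes "s \<in> {1, -1}" "t \<in> {1, -1}" "s' \<in> {1, -1}" "t' \<in> {1, -1}"
    and "s + s' = 0 \<or> p = 0" "t + t' = 0 \<or> q = 0"
    and "r = of_int t' * b * p + of_int s * a * q" "r = of_int t * b * p + of_int s' * a * q"
  shows "sign_conditions s t s' t' a b p q r"
proof (cases "s' = s"; cases "t' = t")
  assume "s' = s" "t' = t"
  then show ?thesis using assms by (auto simp: sign_conditions_def)
next
  assume "s' = s" "t' \<noteq> t"
  then show ?thesis using assms by (auto simp: sign_conditions_def)
next
  assume "s' \<noteq> s" "t' = t"
  then show ?thesis using assms by (auto simp: sign_conditions_def)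
next
  assume "s' \<noteq> s" "t' \<noteq> t"
  then have st: "s' = - s" "t' = - t" using assms(1-4) by auto
  \<comment> \<open>With both signs flipped, the two formulas for \<open>r\<close> are negatives of
    each other; equating them gives the relation between \<open>p\<close> and \<open>q\<close>, and
    then \<open>r = 0\<close>.\<close>
  then have "2 * (of_int t * b * p) = 2 * (of_int s * a * q)"
    using assms(7,8) by (simp add: algebra_simps)
  then have eq: "of_int t * b * p = of_int s * a * q" by simp
  have "r = 0" using assms(7) eq st by simp
  moreover have "a * q = of_int s * (of_int s * a * q)" using assms(1) by auto
  then have "a * q = of_int (s * t) * b * p" unfolding eq[symmetric] by (simp add: mult.assoc)
  ultimately show ?thesis using st by (simp add: sign_conditions_def)
qed

text \<open>This is the product rule for two general elements with coordinates
  \<open>x, y, z, w\<close> and \<open>x', y', z', w'\<close>. The left side is D of the product,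
  whose constant coordinate is lost because D(1) = 0. In each sign pattern it is a polynomial
  identity modulo the squares of the signs being 1.\<close>

lemma twisted_product_identity:
  fixes a b p q r :: "'a::field_char_0"
  assumes "a \<noteq> 0" and st: "s \<in> {1, -1}" "t \<in> {1, -1}"
    and "sign_conditions s t s' t' a b p q r"
  shows "(x * y' + y * x' + b * b * z * w' + b * b * w * z') * p
      + (x * z' + z * x' + a * a * y * w' + a * a * w * y') * q
      + (x * w' + w * x' + y * z' + z * y') * r =
    (y * p + z * q + w * r) *
      (x' + of_int s' * y' * a + of_int t' * z' * b + of_int s' * of_int t' * w' * (a * b))
    + (x + of_int s * y * a + of_int t * z * b + of_int s * of_int t * w * (a * b)) *
      (y' * p + z' * q + w' * r)"
proof -
  define u v :: 'a where "u = of_int s" and "v = of_int t"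
  note uv = u_def[symmetric] v_def[symmetric]
  have sq: "u * u = 1" "v * v = 1"
    using st by (auto simp: u_def v_def)
  from assms(4) consider "p = 0" "q = 0" "r = 0"
    | "s' = s" "t' = - t" "p = 0" "r = of_int s * a * q"
    | "s' = - s" "t' = t" "q = 0" "r = of_int t * b * p"
    | "s' = - s" "t' = - t" "a * q = of_int (s * t) * b * p" "r = 0"
    unfolding sign_conditions_def by blast
  then show ?thesis
  \<comment> \<open>The unqualified name \<open>algebra\<close> denotes the method of HOL-Algebra.\<close>
  proof cases
    case 1
    then show ?thesis by simp
  next
    case 2
    show ?thesis unfolding 2 of_int_minus uv using sq by Groebner_Basis.algebra
  next
    case 3
    show ?thesis unfolding 3 of_int_minus uv using sq by Groebner_Basis.algebra
  next
    case 4
    \<comment> \<open>The relation between \<open>p\<close> and \<open>q\<close> is solved by a free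
      parameter: both become multiples of \<open>h\<close>, which leaves an identity without side
      condition on them.\<close>
    define h where "h = p / a"
    have p: "p = a * h" using assms(1) by (simp add: h_def)
    have q: "q = u * v * b * h"
      using 4(3) assms(1) by (simp add: p uv field_simps)
    show ?thesis unfolding 4(1,2,4) p q of_int_minus uv using sq by Groebner_Basis.algebra
  qed
qed

text \<open>An abstract injective \<open>\<phi>\<close> stands for the map from signs to
  endomorphisms, so that only finitely many sign patterns have to be compared. The three cases
  exclude each other because each makes a different one of \<open>p\<close>, \<open>q\<close>,
  \<open>r\<close> the only zero.\<close>

lemma sign_conditions_iff_exactly_one:
  fixes a b p q r :: "'a::field_char_0"
  assumes nz: "p \<noteq> 0 \<or> q \<noteq> 0 \<or> r \<noteq> 0" "a \<noteq> 0" "b \<noteq> 0"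
    and inj: "\<And>s t s' t'. \<phi> s t = \<phi> s' t' \<longleftrightarrow> s = s' \<and> t = t'"
    and signs: "s \<in> {1, -1}" "t \<in> {1, -1}" "s' \<in> {1, -1}" "t' \<in> {1, -1}"
  shows "sign_conditions s t s' t' a b p q r \<longleftrightarrow>
    exactly_one
      (p = 0 \<and> q \<noteq> 0 \<and> r \<noteq> 0 \<and>
        ((\<phi> s t, \<phi> s' t') \<in> {(\<phi> 1 1, \<phi> 1 (-1)), (\<phi> 1 (-1), \<phi> 1 1)} \<and>
           r = a * q \<or>
         (\<phi> s t, \<phi> s' t') \<in> {(\<phi> (-1) 1, \<phi> (-1) (-1)), (\<phi> (-1) (-1), \<phi> (-1) 1)} \<and>
           r = - a * q))
      (p \<noteq> 0 \<and> q = 0 \<and> r \<noteq> 0 \<and>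
        ((\<phi> s t, \<phi> s' t') \<in> {(\<phi> 1 1, \<phi> (-1) 1), (\<phi> (-1) 1, \<phi> 1 1)} \<and>
           r = b * p \<or>
         (\<phi> s t, \<phi> s' t') \<in> {(\<phi> 1 (-1), \<phi> (-1) (-1)), (\<phi> (-1) (-1), \<phi> 1 (-1))} \<and>
           r = - b * p))
      (p \<noteq> 0 \<and> q \<noteq> 0 \<and> r = 0 \<and>
        ((\<phi> s t, \<phi> s' t') \<in> {(\<phi> 1 1, \<phi> (-1) (-1)), (\<phi> (-1) (-1), \<phi> 1 1)} \<and>
           a * q = b * p \<or>
         (\<phi> s t, \<phi> s' t') \<in> {(\<phi> 1 (-1), \<phi> (-1) 1), (\<phi> (-1) 1, \<phi> 1 (-1))} \<and>
           a * q = - b * p))"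
proof -
  \<comment> \<open>As \<open>a\<close> and \<open>b\<close> are non-zero, each proportionality
    makes its two values vanish together; this supplies the inequations demanded in the three
    cases.\<close>
  have zero: "r = a * q \<longrightarrow> (r = 0 \<longleftrightarrow> q = 0)" "r = - (a * q) \<longrightarrow> (r = 0 \<longleftrightarrow> q = 0)"
    "r = b * p \<longrightarrow> (r = 0 \<longleftrightarrow> p = 0)" "r = - (b * p) \<longrightarrow> (r = 0 \<longleftrightarrow> p = 0)"
    "a * q = b * p \<longrightarrow> (q = 0 \<longleftrightarrow> p = 0)" "a * q = - (b * p) \<longrightarrow> (q = 0 \<longleftrightarrow> p = 0)"
    using nz(2,3) by auto
  have conds: "sign_conditions s t s' t' a b p q r \<longleftrightarrow>
    s' = s \<and> t' = - t \<and> p = 0 \<and> r = of_int s * (a * q) \<or>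
    s' = - s \<and> t' = t \<and> q = 0 \<and> r = of_int t * (b * p) \<or>
    s' = - s \<and> t' = - t \<and> a * q = of_int (s * t) * (b * p) \<and> r = 0"
    unfolding sign_conditions_def mult.assoc using nz(1) by blast
  show ?thesis
    \<comment> \<open>Injectivity turns equations between endomorphisms into equations between
      signs. In each of the sixteen sign patterns a propositional statement about the vanishing of
      \<open>p\<close>, \<open>q\<close>, \<open>r\<close> remains.\<close>
    unfolding conds exactly_one_def prod.inject insert_iff empty_iff inj mult_minus_left
    using signs
    by (elim insertE emptyE; hypsubst; simp; use nz(1) zero in blast)
qed

section \<open>The ring and its endomorphisms\<close>

text \<open>Integer multiples are repeated sums, so additivity on an additive subgroup already gives
  compatibility with them. Membership is part of the conclusion because the induction needs it to
  apply additivity.\<close>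

lemma additive_of_int_mult:
  fixes f :: "'a::ring_1 \<Rightarrow> 'b::ring_1"
  assumes add: "\<forall>x\<in>A. \<forall>y\<in>A. f (x + y) = f x + f y"
    and A: "0 \<in> A" "\<forall>x\<in>A. - x \<in> A" "\<forall>x\<in>A. \<forall>y\<in>A. x + y \<in> A"
    and x: "x \<in> A"
  shows "of_int k * x \<in> A \<and> f (of_int k * x) = of_int k * f x"
proof -
  have f0: "f 0 = 0" using add A(1) by (metis add_0_left add_cancel_right_left)
  have minus: "f (- x) = - f x"
    using add A(2) x f0 by (metis add.left_inverse eq_neg_iff_add_eq_0)
  have nat: "of_nat j * y \<in> A \<and> f (of_nat j * y) = of_nat j * f y" if "y \<in> A" for j y
    by (induction j) (use that A add f0 in \<open>auto simp: distrib_right\<close>)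
  show ?thesis
  proof (cases k)
    case (nonneg j)
    then show ?thesis using nat[OF x, of j] by simp
  next
    case (neg j)
    \<comment> \<open>In this case \<open>k = - int (Suc j)\<close>, so the multiple is taken of
      \<open>- x\<close>.\<close>
    then have "(of_int k * x :: 'a) = of_nat (Suc j) * (- x)"
      and "of_int k * f x = of_nat (Suc j) * (- f x)" by (simp_all del: of_nat_Suc)
    then show ?thesis using nat[of "- x" "Suc j"] A(2) x minus by simp
  qed
qed

locale biquadratic =
  fixes m n :: int
  assumes dimension_4: "ring.dimension complex_ring 4 \<rat> (biquad_field m n)"
begin

abbreviation "A \<equiv> biquad_ring m n"

definition comb :: "int \<Rightarrow> int \<Rightarrow> int \<Rightarrow> int \<Rightarrow> complex" where
  "comb x y z w = of_int x + of_int y * rt m + of_int z * rt n + of_int w * (rt m * rt n)"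

text \<open>Uniqueness of integer coordinates is the independence coming from degree 4; from here
  on, equations in \<open>A\<close> can be checked on quadruples of integers.\<close>

lemma comb_eq_iff: "comb x y z w = comb x' y' z' w' \<longleftrightarrow> x = x' \<and> y = y' \<and> z = z' \<and> w = w'"
proof
  assume "comb x y z w = comb x' y' z' w'"
  then have "of_int (x - x') + of_int (y - y') * rt m + of_int (z - z') * rt n
      + of_int (w - w') * (rt m * rt n) = 0"
    by (simp add: comb_def algebra_simps)
  from biquad_independent[OF dimension_4 _ _ _ _ this]
  show "x = x' \<and> y = y' \<and> z = z' \<and> w = w'" by simp
qed simp

lemma comb_add: "comb x y z w + comb x' y' z' w' = comb (x + x') (y + y') (z + z') (w + w')"
  by (simp add: comb_def algebra_simps)

lemma comb_minus: "- comb x y z w = comb (- x) (- y) (- z) (- w)"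
  by (simp add: comb_def)

lemma comb_mult:
  "comb x y z w * comb x' y' z' w' =
    comb (x * x' + m * y * y' + n * z * z' + m * n * w * w')
      (x * y' + y * x' + n * z * w' + n * w * z')
      (x * z' + z * x' + m * y * w' + m * w * y')
      (x * w' + w * x' + y * z' + z * y')"
proof -
  \<comment> \<open>The expansion is done for arbitrary \<open>a\<close> and \<open>b\<close> with
    the squares isolated, so that \<open>rt_squared\<close> can then replace them.\<close>
  have "(of_int x + of_int y * a + of_int z * b + of_int w * (a * b)) *
      (of_int x' + of_int y' * a + of_int z' * b + of_int w' * (a * b)) =
    (of_int (x * x') + a * a * of_int (y * y') + b * b * of_int (z * z')
      + (a * a) * (b * b) * of_int (w * w'))
    + (of_int (x * y' + y * x') + b * b * of_int (z * w' + w * z')) * a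
    + (of_int (x * z' + z * x') + a * a * of_int (y * w' + w * y')) * b
    + of_int (x * w' + w * x' + y * z' + z * y') * (a * b)" for a b :: complex
    by (simp add: algebra_simps)
  from this[of "rt m" "rt n"] show ?thesis
    unfolding rt_squared by (simp add: comb_def algebra_simps)
qed

lemma comb_basis: "comb 1 0 0 0 = 1" "comb 0 1 0 0 = rt m" "comb 0 0 1 0 = rt n"
  "comb 0 0 0 1 = rt m * rt n"
  by (simp_all add: comb_def)

lemma ring_closed:
  shows one_in: "1 \<in> A" and rt_m_in: "rt m \<in> A" and rt_n_in: "rt n \<in> A"
    and minus_in: "\<And>x. x \<in> A \<Longrightarrow> - x \<in> A"
    and add_in: "\<And>x y. x \<in> A \<Longrightarrow> y \<in> A \<Longrightarrow> x + y \<in> A"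
    and mult_in: "\<And>x y. x \<in> A \<Longrightarrow> y \<in> A \<Longrightarrow> x * y \<in> A"
  unfolding biquad_ring_def
  using generate_ring.intros[where R = complex_ring and H = "{rt m, rt n}"] by simp_all

lemma zero_in: "0 \<in> A"
  using add_in[OF one_in minus_in[OF one_in]] by simp

lemma additive_scale:
  assumes "\<forall>x\<in>A. \<forall>y\<in>A. f (x + y) = f x + f y" and "x \<in> A"
  shows "f (of_int k * x) = of_int k * f x"
  using additive_of_int_mult[of A f] assms zero_in minus_in add_in by blast

lemma of_int_mult_in: "x \<in> A \<Longrightarrow> of_int k * x \<in> A"
  \<comment> \<open>The identity serves as additive map; only the membership half matters.\<close>
  using additive_of_int_mult[of A id x k] zero_in minus_in add_in by simp

lemma comb_in: "comb x y z w \<in> A"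
  using of_int_mult_in[OF one_in, of x] unfolding comb_def
  by (auto intro!: add_in of_int_mult_in rt_m_in rt_n_in mult_in)

text \<open>The integer combinations contain the generators and are closed under the ring
  operations, so they exhaust the generated ring.\<close>

lemma in_ringE:
  assumes "u \<in> A"
  obtains x y z w where "u = comb x y z w"
proof -
  have "\<exists>x y z w. u = comb x y z w"
    using assms unfolding biquad_ring_def
  proof induction
    case one
    then show ?case using comb_basis(1) by (metis ring_of_type_algebra_simps(4))
  next
    case (incl h)
    then show ?case using comb_basis(2,3) by (metis insertE singletonD)
  next
    case (a_inv h)
    then show ?case by (metis comb_minus ring_of_type_algebra_a_inv)
  next
    case (eng_add h1 h2)
    then show ?case by (metis comb_add ring_of_type_algebra_simps(3))
  next
    case (eng_mult h1 h2)
    then show ?case by (metis comb_mult ring_of_type_algebra_simps(2))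
  qed
  then show ?thesis using that by blast
qed

text \<open>Serves both for endomorphisms and for D: each is determined on \<open>A\<close> by its
  values at the four basis elements.\<close>

lemma additive_comb:
  assumes add: "\<forall>x\<in>A. \<forall>y\<in>A. f (x + y) = f x + f y"
  shows "f (comb x y z w) = of_int x * f 1 + of_int y * f (rt m) + of_int z * f (rt n)
    + of_int w * f (rt m * rt n)"
proof -
  note in_A = one_in rt_m_in rt_n_in mult_in[OF rt_m_in rt_n_in]
  have "f (comb x y z w) = f (of_int x * 1 + of_int y * rt m + of_int z * rt n
      + of_int w * (rt m * rt n))"
    by (simp add: comb_def)
  also have "\<dots> = f (of_int x * 1) + f (of_int y * rt m) + f (of_int z * rt n)
      + f (of_int w * (rt m * rt n))"
    using add by (simp only: of_int_mult_in add_in in_A)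
  finally show ?thesis
    by (simp only: additive_scale[OF add] in_A)
qed

section \<open>Endomorphisms of \<open>A\<close> as sign changes\<close>

definition sign_map :: "int \<Rightarrow> int \<Rightarrow> complex \<Rightarrow> complex" where
  "sign_map s t = (\<lambda>u\<in>A. THE v. \<exists>x y z w. u = comb x y z w \<and> v = comb x (s * y) (t * z) (s * t * w))"

text \<open>Uniqueness of coordinates makes the description by \<open>THE\<close> well
  defined.\<close>

lemma sign_map_comb: "sign_map s t (comb x y z w) = comb x (s * y) (t * z) (s * t * w)"
  unfolding sign_map_def restrict_def
  by (simp add: comb_in) (rule the_equality, auto simp: comb_eq_iff)

lemma sign_map_rt: "sign_map s t (rt m) = of_int s * rt m" "sign_map s t (rt n) = of_int t * rt n"
  using sign_map_comb[of s t 0 1 0 0] sign_map_comb[of s t 0 0 1 0] by (simp_all add: comb_def)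

text \<open>Multiplicativity is checked in coordinates, where the signs match because
  \<open>s * s = 1\<close> and \<open>t * t = 1\<close>.\<close>

lemma sign_map_endo:
  assumes "s \<in> {1, -1}" "t \<in> {1, -1}"
  shows "sign_map s t \<in> nonzero_ring_endos A"
proof -
  have "sign_map s t 1 \<noteq> 0"
    using sign_map_comb[of s t 1 0 0 0] by (simp add: comb_def)
  moreover have "sign_map s t (u + v) = sign_map s t u + sign_map s t v"
    if "u \<in> A" "v \<in> A" for u v
    using that by (elim in_ringE) (simp add: sign_map_comb comb_add algebra_simps)
  moreover have "sign_map s t (u * v) = sign_map s t u * sign_map s t v"
    if "u \<in> A" "v \<in> A" for u v
    using that by (elim in_ringE) (use assms in \<open>auto simp: sign_map_comb comb_mult comb_eq_iff\<close>)
  moreover have "sign_map s t u \<in> A" if "u \<in> A" for u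
    using that by (elim in_ringE) (simp add: sign_map_comb comb_in)
  moreover have "sign_map s t \<in> extensional A" by (simp add: sign_map_def)
  ultimately show ?thesis
    unfolding nonzero_ring_endos_def PiE_def using one_in by blast
qed

text \<open>Cancel a non-zero value \<open>f x\<close> in \<open>f x = f 1 * f x\<close>.\<close>

lemma endo_one:
  assumes "f \<in> nonzero_ring_endos A"
  shows "f 1 = 1"
proof -
  from assms obtain x where x: "x \<in> A" "f x \<noteq> 0"
    and mult: "\<And>x y. x \<in> A \<Longrightarrow> y \<in> A \<Longrightarrow> f (x * y) = f x * f y"
    unfolding nonzero_ring_endos_def by blast
  show ?thesis using mult[OF one_in x(1)] x(2) by simp
qed

text \<open>Preserving 1 and products fixes the values at the other two basis elements;
  extensionality then turns agreement on \<open>A\<close> into equality.\<close>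

lemma endo_eqI:
  assumes f: "f \<in> nonzero_ring_endos A" and g: "g \<in> nonzero_ring_endos A"
    and "f (rt m) = g (rt m)" "f (rt n) = g (rt n)"
  shows "f = g"
proof (rule extensionalityI[of _ A])
  show "f \<in> extensional A" "g \<in> extensional A"
    using f g by (auto simp: nonzero_ring_endos_def PiE_def)
  have add: "\<forall>x\<in>A. \<forall>y\<in>A. h (x + y) = h x + h y"
    and mult: "h (rt m * rt n) = h (rt m) * h (rt n)"
    if "h \<in> nonzero_ring_endos A" for h
    using that rt_m_in rt_n_in by (auto simp: nonzero_ring_endos_def)
  fix u assume "u \<in> A"
  then obtain x y z w where "u = comb x y z w" by (rule in_ringE)
  then show "f u = g u"
    by (simp add: additive_comb[OF add] f g mult endo_one assms)
qed

text \<open>The square of \<open>f (rt k)\<close> is \<open>f\<close> of the integer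
  \<open>k\<close>, which is \<open>k\<close> itself, so \<open>f (rt k)\<close> is one of the two
  square roots of \<open>k\<close>.\<close>

lemma endo_eq_sign_map:
  assumes f: "f \<in> nonzero_ring_endos A"
  obtains s t where "s \<in> {1, -1}" "t \<in> {1, -1}" "f = sign_map s t"
proof -
  have root: "\<exists>s \<in> {1, -1}. f (rt k) = of_int s * rt k" if k: "rt k \<in> A" for k
  proof -
    have add: "\<forall>x\<in>A. \<forall>y\<in>A. f (x + y) = f x + f y"
      and mult: "f (rt k * rt k) = f (rt k) * f (rt k)"
      using f k by (auto simp: nonzero_ring_endos_def)
    have "f (rt k) * f (rt k) = f (of_int k * 1)"
      using mult by (simp add: rt_squared)
    also have "\<dots> = of_int k * f 1"
      by (rule additive_scale[OF add one_in])
    also have "\<dots> = rt k * rt k"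
      using endo_one[OF f] by (simp add: rt_squared)
    finally show ?thesis
      using square_eq_iff[of "f (rt k)" "rt k"] by auto
  qed
  obtain s where s: "s \<in> {1, -1}" "f (rt m) = of_int s * rt m"
    using root[OF rt_m_in] by (rule bexE)
  obtain t where t: "t \<in> {1, -1}" "f (rt n) = of_int t * rt n"
    using root[OF rt_n_in] by (rule bexE)
  have "f = sign_map s t"
    by (rule endo_eqI[OF f sign_map_endo[OF s(1) t(1)]]) (simp_all only: s t sign_map_rt)
  then show ?thesis by (rule that[OF s(1) t(1)])
qed

text \<open>The sign map gives existence and \<open>endo_eqI\<close> uniqueness for the definite
  description.\<close>

lemma biquad_endo_eq:
  assumes "s \<in> {1, -1}" "t \<in> {1, -1}"
  shows "biquad_endo m n (of_int s * rt m) (of_int t * rt n) = sign_map s t"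
  unfolding biquad_endo_def
proof (rule the_equality)
  show "sign_map s t \<in> nonzero_ring_endos A \<and> sign_map s t (rt m) = of_int s * rt m
    \<and> sign_map s t (rt n) = of_int t * rt n"
    using sign_map_endo[OF assms] sign_map_rt by simp
next
  fix f assume "f \<in> nonzero_ring_endos A \<and> f (rt m) = of_int s * rt m
    \<and> f (rt n) = of_int t * rt n"
  then show "f = sign_map s t"
    using endo_eqI[OF _ sign_map_endo[OF assms]] sign_map_rt by simp
qed

lemma phi_eq_sign_map:
  "phi1 m n = sign_map 1 1" "phi2 m n = sign_map 1 (-1)"
  "phi3 m n = sign_map (-1) 1" "phi4 m n = sign_map (-1) (-1)"
  using biquad_endo_eq[of 1 1] biquad_endo_eq[of 1 "-1"] biquad_endo_eq[of "-1" 1]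
    biquad_endo_eq[of "-1" "-1"]
  by (simp_all add: phi1_def phi2_def phi3_def phi4_def)

lemma sign_map_eq_iff: "sign_map s t = sign_map s' t' \<longleftrightarrow> s = s' \<and> t = t'"
proof
  assume "sign_map s t = sign_map s' t'"
  \<comment> \<open>Both maps are evaluated at \<open>rt m + rt n\<close>, whose image shows both
    signs as coordinates.\<close>
  then have "comb 0 (s * 1) (t * 1) (s * t * 0) = comb 0 (s' * 1) (t' * 1) (s' * t' * 0)"
    by (simp only: sign_map_comb[symmetric])
  then show "s = s' \<and> t = t'"
    by (simp add: comb_eq_iff)
qed simp

lemma rt_nonzero: "rt m \<noteq> 0" "rt n \<noteq> 0"
  using comb_eq_iff[of 0 1 0 0 0 0 0 0] comb_eq_iff[of 0 0 1 0 0 0 0 0] by (auto simp: comb_def)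

section \<open>Twisted derivations\<close>

text \<open>Necessity uses the product rule at four pairs of roots only; sufficiency follows in
  coordinates from \<open>twisted_product_identity\<close>.\<close>

lemma twisted_derivation_iff:
  assumes lin: "Z_linear_on A D" and D1: "D 1 = 0"
    and signs: "s \<in> {1, -1}" "t \<in> {1, -1}" "s' \<in> {1, -1}" "t' \<in> {1, -1}"
  shows "twisted_derivation A (sign_map s t) (sign_map s' t') D \<longleftrightarrow>
    sign_conditions s t s' t' (rt m) (rt n) (D (rt m)) (D (rt n)) (D (rt m * rt n))"
    (is "?tw \<longleftrightarrow> ?conds")
proof
  have scale: "D (of_int k * x) = of_int k * D x" if "x \<in> A" for k x
    using lin that by (simp add: Z_linear_on_def)
  have Dint: "D (of_int k) = 0" for k
    using scale[OF one_in, of k] D1 by simp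
  assume ?tw
  then have prod: "D (x * y) = D x * sign_map s' t' y + sign_map s t x * D y"
    if "x \<in> A" "y \<in> A" for x y
    using that by (simp add: twisted_derivation_def)
  show ?conds
  proof (rule sign_conditionsI[OF signs])
    \<comment> \<open>The square of \<open>rt m\<close> is an integer and D vanishes on integers, so
      the product rule at this square has left side 0.\<close>
    have "of_int (s + s') * rt m * D (rt m) = 0"
      using prod[OF rt_m_in rt_m_in] by (simp add: rt_squared Dint sign_map_rt algebra_simps)
    then show "s + s' = 0 \<or> D (rt m) = 0"
      using rt_nonzero by (simp del: of_int_add)
    have "of_int (t + t') * rt n * D (rt n) = 0"
      using prod[OF rt_n_in rt_n_in] by (simp add: rt_squared Dint sign_map_rt algebra_simps)
    then show "t + t' = 0 \<or> D (rt n) = 0"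
      using rt_nonzero by (simp del: of_int_add)
    show "D (rt m * rt n) = of_int t' * rt n * D (rt m) + of_int s * rt m * D (rt n)"
      using prod[OF rt_m_in rt_n_in] by (simp add: sign_map_rt algebra_simps)
    \<comment> \<open>The factors are taken in the other order: the ring is commutative, but the
      twisted rule is not symmetric in them.\<close>
    show "D (rt m * rt n) = of_int t * rt n * D (rt m) + of_int s' * rt m * D (rt n)"
      using prod[OF rt_n_in rt_m_in] by (simp add: sign_map_rt algebra_simps)
  qed
next
  assume conds: ?conds
  have D_comb: "D (comb x y z w) = of_int y * D (rt m) + of_int z * D (rt n)
      + of_int w * D (rt m * rt n)" for x y z w
    using additive_comb[of D x y z w] lin D1 by (simp add: Z_linear_on_def)
  have "D (u * v) = D u * sign_map s' t' v + sign_map s t u * D v" if "u \<in> A" "v \<in> A" for u v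
  proof -
    obtain x y z w x' y' z' w' where uv: "u = comb x y z w" "v = comb x' y' z' w'"
      using \<open>u \<in> A\<close> \<open>v \<in> A\<close> by (elim in_ringE)
    have "D (u * v) =
      (of_int x * of_int y' + of_int y * of_int x' + of_int n * of_int z * of_int w'
        + of_int n * of_int w * of_int z') * D (rt m)
      + (of_int x * of_int z' + of_int z * of_int x' + of_int m * of_int y * of_int w'
        + of_int m * of_int w * of_int y') * D (rt n)
      + (of_int x * of_int w' + of_int w * of_int x' + of_int y * of_int z'
        + of_int z * of_int y') * D (rt m * rt n)"
      by (simp add: uv comb_mult D_comb)
    also have "\<dots> = D u * sign_map s' t' v + sign_map s t u * D v"
      \<comment> \<open>The instances follow the order in which the variables first occur in the
        identity.\<close>
      using twisted_product_identity[OF rt_nonzero(1) signs(1,2) conds, of "of_int x" "of_int y'"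
          "of_int y" "of_int x'" "of_int z" "of_int w'" "of_int w" "of_int z'"]
      by (simp only: uv D_comb sign_map_comb) (simp only: rt_squared comb_def of_int_mult)
    finally show ?thesis .
  qed
  then show ?tw
    using lin by (simp add: twisted_derivation_def)
qed

end

theorem theorem3p18:
  fixes m n :: int and \<sigma> \<tau> D :: "complex \<Rightarrow> complex"
  assumes "m \<noteq> n" and "squarefree m" and "squarefree n"
    and "ring.dimension complex_ring 4 \<rat> (biquad_field m n)"
    and "\<sigma> \<in> nonzero_ring_endos (biquad_ring m n)"
    and "\<tau> \<in> nonzero_ring_endos (biquad_ring m n)"
    and "Z_linear_on (biquad_ring m n) D"
    and "\<exists>x\<in>biquad_ring m n. D x \<noteq> 0"
    and "D 1 = 0"
  shows "twisted_derivation (biquad_ring m n) \<sigma> \<tau> D \<longleftrightarrow>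
    exactly_one
      (D (rt m) = 0 \<and> D (rt n) \<noteq> 0 \<and> D (rt m * rt n) \<noteq> 0 \<and>
        ((\<sigma>, \<tau>) \<in> {(phi1 m n, phi2 m n), (phi2 m n, phi1 m n)} \<and>
           D (rt m * rt n) = rt m * D (rt n) \<or>
         (\<sigma>, \<tau>) \<in> {(phi3 m n, phi4 m n), (phi4 m n, phi3 m n)} \<and>
           D (rt m * rt n) = - rt m * D (rt n)))
      (D (rt m) \<noteq> 0 \<and> D (rt n) = 0 \<and> D (rt m * rt n) \<noteq> 0 \<and>
        ((\<sigma>, \<tau>) \<in> {(phi1 m n, phi3 m n), (phi3 m n, phi1 m n)} \<and>
           D (rt m * rt n) = rt n * D (rt m) \<or>
         (\<sigma>, \<tau>) \<in> {(phi2 m n, phi4 m n), (phi4 m n, phi2 m n)} \<and>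
           D (rt m * rt n) = - rt n * D (rt m)))
      (D (rt m) \<noteq> 0 \<and> D (rt n) \<noteq> 0 \<and> D (rt m * rt n) = 0 \<and>
        ((\<sigma>, \<tau>) \<in> {(phi1 m n, phi4 m n), (phi4 m n, phi1 m n)} \<and>
           rt m * D (rt n) = rt n * D (rt m) \<or>
         (\<sigma>, \<tau>) \<in> {(phi2 m n, phi3 m n), (phi3 m n, phi2 m n)} \<and>
           rt m * D (rt n) = - rt n * D (rt m)))"
proof -
  interpret biquadratic m n by unfold_locales (rule assms)
  obtain s t where st: "s \<in> {1, -1}" "t \<in> {1, -1}" "\<sigma> = sign_map s t"
    using endo_eq_sign_map[OF assms(5)] by blast
  obtain s' t' where st': "s' \<in> {1, -1}" "t' \<in> {1, -1}" "\<tau> = sign_map s' t'"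
    using endo_eq_sign_map[OF assms(6)] by blast
  \<comment> \<open>D is determined by its basis values and D(1) = 0, so a D that is non-zero on
    \<open>A\<close> is non-zero at one of the three remaining basis elements.\<close>
  have nonzero: "D (rt m) \<noteq> 0 \<or> D (rt n) \<noteq> 0 \<or> D (rt m * rt n) \<noteq> 0"
  proof (rule ccontr)
    assume *: "\<not> ?thesis"
    have "D u = 0" if "u \<in> A" for u
      using that assms(7,9) * additive_comb[of D] by (elim in_ringE) (simp add: Z_linear_on_def)
    then show False using assms(8) by blast
  qed
  show ?thesis
    \<comment> \<open>Once both endomorphisms and the four named ones are sign maps,
      \<open>sign_map\<close> takes the role of the injective \<open>\<phi>\<close>.\<close>
    unfolding st(3) st'(3) twisted_derivation_iff[OF assms(7,9) st(1,2) st'(1,2)] phi_eq_sign_map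
    by (rule sign_conditions_iff_exactly_one[OF nonzero rt_nonzero sign_map_eq_iff
          st(1,2) st'(1,2)])
qed

end
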